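(* Let $X$ be an ultranormal $\sigma$-compact locally compact Hausdorff space, and let $A$ be a non-empty closed subset of $X$. If $Y$ is a non-compact metrizable space, then every continuous proper map $f\colon A\to Y$ can be extended to a continuous proper map $F\colon X\to Y$ (that is, $F|_{A}=f$).
   Context: A topological space $X$ is ultranormal if for every pair $A,B$ of disjoint closed subsets of $X$ there is a clopen set $V$ with $A\subset V$ and $V\cap B=\emptyset$. A map between topological spaces is proper if inverse images of compact sets are compact. A space is $\sigma$-compact if it is a countable union of compact subspaces, and locally compact if every point has a compact neighborhood. *)

theory Defs
  imports "HOL-Analysis.Analysis"
begin

definition ultranormal_space :: "'a topology \<Rightarrow> bool" where
  "ultranormal_space X \<longleftrightarrow>
     (\<forall>A B. closedin X A \<and> closedin X B \<and> A \<inter> B = {} \<longrightarrow>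
        (\<exists>V. openin X V \<and> closedin X V \<and> A \<subseteq> V \<and> V \<inter> B = {}))"

definition sigma_compact_space :: "'a topology \<Rightarrow> bool" where
  "sigma_compact_space X \<longleftrightarrow>
     (\<exists>\<K>. countable \<K> \<and> (\<forall>K\<in>\<K>. compactin X K) \<and> \<Union>\<K> = topspace X)"

(* Proper in the sense that inverse images of compact sets are compact. The library's
   proper_map (closed with compact fibres) is in general a different notion. *)
definition compact_preimage_map :: "'a topology \<Rightarrow> 'b topology \<Rightarrow> ('a \<Rightarrow> 'b) \<Rightarrow> bool" where
  "compact_preimage_map X Y f \<longleftrightarrow>
     f \<in> topspace X \<rightarrow> topspace Y \<and>
     (\<forall>K. compactin Y K \<longrightarrow> compactin X {x \<in> topspace X. f x \<in> K})"

end

theory Submission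
  imports Defs
begin

text \<open>
  The space \<open>X\<close> splits into countably many disjoint compact clopen pieces \<open>U n\<close>. On a piece that
  meets \<open>A\<close>, extend \<open>f\<close> with values in the compact metrizable set \<open>f ` (A \<inter> U n)\<close>; this is possible
  by successive approximation, because in an ultranormal space closed covers of \<open>A\<close> can be
  swollen to clopen sets. On a piece missing \<open>A\<close>, take the constant \<open>y n\<close>, where \<open>y\<close> is a sequence in
  \<open>Y\<close> that visits every compact set only finitely often. A compact \<open>K\<close> that meets the image of a
  piece of the first kind meets \<open>f ` (A \<inter> U n)\<close>, so properness of \<open>f\<close> leaves only finitely many such
  pieces.
\<close>

text \<open>The frontier of a clopen set is empty, so a constant can be put in place of
  \<open>g\<close> there without losing continuity; finite induction does this for one
  \<open>c\<close> after another. The sets \<open>W c\<close> may overlap, and a later override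
  wins, hence the conclusion only says that \<open>h x\<close> is some \<open>c\<close> with
  \<open>x \<in> W c\<close>.\<close>

lemma continuous_map_const_on_finite_clopens:
  assumes "finite K" "K \<subseteq> topspace Y" "continuous_map X Y g"
    and "\<And>c. c \<in> K \<Longrightarrow> openin X (W c) \<and> closedin X (W c)"
  shows "\<exists>h. continuous_map X Y h \<and>
    (\<forall>x \<in> topspace X. if \<exists>c\<in>K. x \<in> W c then \<exists>c\<in>K. x \<in> W c \<and> h x = c else h x = g x)"
  using assms
proof (induction K rule: finite_induct)
  case empty
  then show ?case by auto
next
  case (insert c K)
  then obtain h where h: "continuous_map X Y h"
    and hx: "\<And>x. x \<in> topspace X \<Longrightarrow>
      if \<exists>c\<in>K. x \<in> W c then \<exists>c\<in>K. x \<in> W c \<and> h x = c else h x = g x"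
    by auto
  have W: "openin X (W c)" "closedin X (W c)"
    using insert.prems by auto
  have "continuous_map X Y (\<lambda>x. if x \<in> W c then c else h x)"
  proof (rule continuous_map_cases)
    show "continuous_map (subtopology X (X closure_of {x. x \<in> W c})) Y (\<lambda>x. c)"
      using insert.prems by auto
    show "continuous_map (subtopology X (X closure_of {x. x \<notin> W c})) Y h"
      using h by (rule continuous_map_from_subtopology)
    show "\<And>x. x \<in> X frontier_of {x. x \<in> W c} \<Longrightarrow> c = h x"
      using W clopenin_eq_frontier_of[of X "W c"] by simp
  qed
  moreover have "\<forall>x \<in> topspace X. if \<exists>c'\<in>insert c K. x \<in> W c'
      then \<exists>c'\<in>insert c K. x \<in> W c' \<and> (if x \<in> W c then c else h x) = c'
      else (if x \<in> W c then c else h x) = g x"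
  proof
    fix x
    assume "x \<in> topspace X"
    then show "if \<exists>c'\<in>insert c K. x \<in> W c'
        then \<exists>c'\<in>insert c K. x \<in> W c' \<and> (if x \<in> W c then c else h x) = c'
        else (if x \<in> W c then c else h x) = g x"
      using hx[of x] by (cases "x \<in> W c"; cases "\<exists>c\<in>K. x \<in> W c") auto
  qed
  ultimately show ?case
    by blast
qed

text \<open>One step of the successive approximation. Take a finite \<open>e'/2\<close>-net
  \<open>K\<close> of \<open>M\<close>; the closed sets of points of \<open>A\<close> where
  \<open>f\<close> is within \<open>e'/2\<close> of \<open>c \<in> K\<close> cover \<open>A\<close>.
  Swell them to clopen sets \<open>W c\<close> and replace \<open>g\<close> by the constant
  \<open>c\<close> on \<open>W c\<close>. The bound on \<open>d (g x) (h x)\<close> over all of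
  \<open>X\<close>, not only over \<open>A\<close>, is what later makes the approximations uniformly
  Cauchy.\<close>

lemma (in Metric_space) ultranormal_refine_approximation:
  assumes X: "ultranormal_space X" and A: "closedin X A"
    and f: "continuous_map (subtopology X A) mtopology f"
    and g: "continuous_map X mtopology g"
    and M: "mtotally_bounded M"
    and gf: "\<And>a. a \<in> A \<Longrightarrow> d (g a) (f a) < e" and "0 < e" "0 < e'"
  shows "\<exists>h. continuous_map X mtopology h \<and> (\<forall>a\<in>A. d (h a) (f a) < e') \<and>
    (\<forall>x\<in>topspace X. d (g x) (h x) < e + e')"
proof -
  obtain K where K: "finite K" "K \<subseteq> M" "M \<subseteq> (\<Union>c\<in>K. mball c (e'/2))"
    using M \<open>0 < e'\<close> unfolding mtotally_bounded_def by (meson half_gt_zero)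
  have AX: "A \<subseteq> topspace X"
    using A closedin_subset by blast
  have fM: "f a \<in> M" if "a \<in> A" for a
    using f that AX by (auto simp: continuous_map_def)
  have gM: "g x \<in> M" if "x \<in> topspace X" for x
    using g that by (auto simp: continuous_map_def)
  have Wex: "\<exists>W. openin X W \<and> closedin X W \<and> {a \<in> A. d c (f a) \<le> e'/2} \<subseteq> W \<and>
      (\<forall>a\<in>A \<inter> W. d c (f a) < e') \<and> (\<forall>x\<in>W. d c (g x) < e + e')" if "c \<in> K" for c
  proof -
    have c: "c \<in> M"
      using that K by auto
    \<comment> \<open>\<open>W\<close> has to contain \<open>?P\<close>. It has to avoid
      \<open>?Q\<close>, where the value \<open>c\<close> is too far from \<open>f\<close>, and
      \<open>?R\<close>, where changing \<open>g\<close> to \<open>c\<close> would move it too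
      far.\<close>
    let ?P = "{a \<in> topspace (subtopology X A). f a \<in> mcball c (e'/2)}"
    let ?Q = "{a \<in> topspace (subtopology X A). f a \<in> topspace mtopology - mball c e'}"
    let ?R = "{x \<in> topspace X. g x \<in> topspace mtopology - mball c (e + e')}"
    have P: "closedin X ?P"
      by (rule closedin_trans_full [OF closedin_continuous_map_preimage[OF f] A]) auto
    have "closedin X ?Q"
      by (rule closedin_trans_full [OF closedin_continuous_map_preimage[OF f] A]) auto
    moreover have "closedin X ?R"
      by (rule closedin_continuous_map_preimage[OF g]) auto
    ultimately have QR: "closedin X (?Q \<union> ?R)"
      by blast
    \<comment> \<open>\<open>?P\<close> misses \<open>?R\<close> because on \<open>?P\<close> the
      distance from \<open>c\<close> to \<open>g a\<close> is below \<open>e'/2 + e\<close>; it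
      misses \<open>?Q\<close> because \<open>e'/2 < e'\<close>.\<close>
    have False if "a \<in> A" "d c (f a) \<le> e'/2" "\<not> d c (g a) < e + e'" for a
    proof -
      have "d c (g a) \<le> d c (f a) + d (g a) (f a)"
        using triangle[of c "f a" "g a"] c fM gM AX that(1) by (auto simp: commute)
      then show False
        using that gf[of a] \<open>0 < e'\<close> by linarith
    qed
    then have "?P \<inter> (?Q \<union> ?R) = {}"
      using \<open>0 < e'\<close> c fM gM AX by (force simp: in_mball in_mcball)
    then obtain W where W: "openin X W" "closedin X W" "?P \<subseteq> W" "W \<inter> (?Q \<union> ?R) = {}"
      using X P QR unfolding ultranormal_space_def by meson
    have "W \<subseteq> topspace X"
      using W(1) by (rule openin_subset)
    have "{a \<in> A. d c (f a) \<le> e'/2} \<subseteq> W"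
      using W(3) c fM AX by auto
    moreover have "d c (f a) < e'" if "a \<in> A \<inter> W" for a
    proof (rule ccontr)
      assume "\<not> d c (f a) < e'"
      then have "a \<in> ?Q"
        using that fM AX by auto
      then show False
        using that W(4) by blast
    qed
    moreover have "d c (g x) < e + e'" if "x \<in> W" for x
    proof (rule ccontr)
      assume "\<not> d c (g x) < e + e'"
      then have "x \<in> ?R"
        using that gM \<open>W \<subseteq> topspace X\<close> by auto
      then show False
        using that W(4) by blast
    qed
    ultimately show ?thesis
      using W(1,2) by blast
  qed
  have "\<exists>W. \<forall>c\<in>K. openin X (W c) \<and> closedin X (W c) \<and> {a \<in> A. d c (f a) \<le> e'/2} \<subseteq> W c \<and>
      (\<forall>a\<in>A \<inter> W c. d c (f a) < e') \<and> (\<forall>x\<in>W c. d c (g x) < e + e')"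
    by (rule bchoice, rule ballI, rule Wex)
  then obtain W where Wall: "\<forall>c\<in>K. openin X (W c) \<and> closedin X (W c) \<and>
      {a \<in> A. d c (f a) \<le> e'/2} \<subseteq> W c \<and>
      (\<forall>a\<in>A \<inter> W c. d c (f a) < e') \<and> (\<forall>x\<in>W c. d c (g x) < e + e')" ..
  then have W: "openin X (W c) \<and> closedin X (W c)" if "c \<in> K" for c
    using that by simp
  have PW: "a \<in> W c" if "c \<in> K" "a \<in> A" "d c (f a) \<le> e'/2" for c a
    using bspec[OF Wall that(1)] that(2,3) by blast
  have Wf: "d c (f a) < e'" if "c \<in> K" "a \<in> A" "a \<in> W c" for c a
    using bspec[OF Wall that(1)] that(2,3) by blast
  have Wg: "d c (g x) < e + e'" if "c \<in> K" "x \<in> W c" for c x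
    using bspec[OF Wall that(1)] that(2) by blast
  obtain h where h: "continuous_map X mtopology h"
    and hx: "\<And>x. x \<in> topspace X \<Longrightarrow>
      if \<exists>c\<in>K. x \<in> W c then \<exists>c\<in>K. x \<in> W c \<and> h x = c else h x = g x"
    using continuous_map_const_on_finite_clopens[of K mtopology X g W] K g W by auto
  have "d (h a) (f a) < e'" if "a \<in> A" for a
  proof -
    obtain c where "c \<in> K" "f a \<in> mball c (e'/2)"
      using fM[OF \<open>a \<in> A\<close>] K(3) by blast
    then have "\<exists>c\<in>K. a \<in> W c"
      using PW[of c a] that by auto
    \<comment> \<open>Every \<open>c\<close> with \<open>a \<in> W c\<close> is within
      \<open>e'\<close> of \<open>f a\<close>, so it does not matter which of them \<open>h\<close>
      takes at \<open>a\<close>.\<close>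
    then show ?thesis
      using hx[of a] that AX Wf by auto
  qed
  moreover have "d (g x) (h x) < e + e'" if "x \<in> topspace X" for x
  proof (cases "\<exists>c\<in>K. x \<in> W c")
    case True
    then show ?thesis
      using hx[OF that] Wg[of "h x" x] commute[of "g x" "h x"] by auto
  next
    case False
    then have "h x = g x"
      using hx[OF that] by simp
    then show ?thesis
      using gM that \<open>0 < e\<close> \<open>0 < e'\<close> by simp
  qed
  ultimately show ?thesis
    using h by blast
qed

text \<open>\<open>F\<close> is the uniform limit of maps \<open>g n\<close> on \<open>X\<close>
  with error below \<open>B / 2^n\<close> on \<open>A\<close>. Compactness of \<open>Y\<close>
  enters three times: boundedness gives the first approximation, total boundedness the refinement
  step, completeness the limit.\<close>

lemma ultranormal_extension:
  assumes X: "ultranormal_space X" and A: "closedin X A"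
    and Y: "compact_space Y" "metrizable_space Y" "topspace Y \<noteq> {}"
    and f: "continuous_map (subtopology X A) Y f"
  obtains F where "continuous_map X Y F" "\<And>a. a \<in> A \<Longrightarrow> F a = f a"
proof -
  obtain M d where "Metric_space M d" and Yd: "Y = Metric_space.mtopology M d"
    using Y unfolding metrizable_space_def by blast
  interpret Metric_space M d by fact
  have AX: "A \<subseteq> topspace X"
    using A closedin_subset by blast
  have com: "compactin mtopology M"
    using Y by (simp add: Yd compact_space_def)
  then have M: "mtotally_bounded M" "mcomplete"
    using Y(1) compactin_imp_mtotally_bounded compact_space_eq_mcomplete_mtotally_bounded
    by (auto simp: Yd)
  have fM: "f a \<in> M" if "a \<in> A" for a
    using f that AX by (auto simp: continuous_map_def Yd)
  obtain c where c: "c \<in> M"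
    using Y by (auto simp: Yd)
  \<comment> \<open>With this strict bound the constant map \<open>c\<close> is an admissible start,
    with error below \<open>B / 2^0\<close>.\<close>
  obtain B where B: "0 < B" "\<And>x. x \<in> M \<Longrightarrow> d c x < B"
  proof -
    have "mbounded M"
      using com by (rule compactin_imp_mbounded)
    then obtain B where "\<And>x. x \<in> M \<Longrightarrow> d c x \<le> B"
      using c unfolding mbounded_alt by blast
    then show thesis
      by (intro that[of "\<bar>B\<bar> + 1"]) fastforce+
  qed
  have "\<exists>g. \<forall>n. (continuous_map X mtopology (g n) \<and> (\<forall>a\<in>A. d (g n a) (f a) < B / 2^n)) \<and>
      (\<forall>x\<in>topspace X. d (g n x) (g (Suc n) x) < B / 2^n + B / 2^Suc n)"
  proof (rule dependent_nat_choice)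
    show "\<exists>g. continuous_map X mtopology g \<and> (\<forall>a\<in>A. d (g a) (f a) < B / 2^0)"
      using c B fM by (intro exI[of _ "\<lambda>x. c"]) auto
    show "\<exists>h. (continuous_map X mtopology h \<and> (\<forall>a\<in>A. d (h a) (f a) < B / 2^Suc n)) \<and>
        (\<forall>x\<in>topspace X. d (g x) (h x) < B / 2^n + B / 2^Suc n)"
      if "continuous_map X mtopology g \<and> (\<forall>a\<in>A. d (g a) (f a) < B / 2^n)" for g n
      using ultranormal_refine_approximation[OF X A f[unfolded Yd] _ M(1),
          of g "B / 2^n" "B / 2^Suc n"] that B(1)
      by auto
  qed
  then obtain g where g: "\<And>n. continuous_map X mtopology (g n)"
    and gf: "\<And>n a. a \<in> A \<Longrightarrow> d (g n a) (f a) < B / 2^n"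
    and gg: "\<And>n x. x \<in> topspace X \<Longrightarrow> d (g n x) (g (Suc n) x) < B / 2^n + B / 2^Suc n"
    by metis
  have gM: "g n x \<in> M" if "x \<in> topspace X" for n x
    using g[of n] that by (auto simp: continuous_map_def)
  \<comment> \<open>The step bound \<open>B / 2^n + B / 2^Suc n\<close> equals
    \<open>3 * B / 2^n - 3 * B / 2^Suc n\<close>, so the sum over consecutive steps
    telescopes.\<close>
  have tail: "d (g n x) (g (n + k) x) \<le> 3 * B / 2^n - 3 * B / 2^(n + k)"
    if x: "x \<in> topspace X" for n k x
  proof (induction k)
    case 0
    then show ?case using gM x by simp
  next
    case (Suc k)
    have "d (g n x) (g (n + Suc k) x) \<le> d (g n x) (g (n + k) x) + d (g (n + k) x) (g (n + Suc k) x)"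
      using gM x triangle by blast
    also have "d (g (n + k) x) (g (n + Suc k) x) \<le> 3 * B / 2^(n + k) - 3 * B / 2^(n + Suc k)"
      using gg[OF x, of "n + k"] by (simp add: field_simps)
    finally show ?case
      using Suc by simp
  qed
  have small: "\<forall>\<^sub>F n in sequentially. C / 2^n < \<epsilon>" if "0 < \<epsilon>" for C \<epsilon> :: real
  proof -
    have "(\<lambda>n. C / 2^n) \<longlonglongrightarrow> 0"
      by (rule LIMSEQ_divide_realpow_zero) simp
    then show ?thesis
      using that by (rule order_tendstoD)
  qed
  have Cauchy: "\<exists>N. \<forall>m n x. N \<le> m \<longrightarrow> N \<le> n \<longrightarrow> x \<in> topspace X \<longrightarrow> d (g m x) (g n x) < \<epsilon>"
    if "0 < \<epsilon>" for \<epsilon>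
  proof -
    obtain N where N: "\<And>n. n \<ge> N \<Longrightarrow> (3 * B) / 2^n < \<epsilon>"
      using small[OF \<open>0 < \<epsilon>\<close>, of "3 * B"] unfolding eventually_sequentially by blast
    have "d (g m x) (g n x) < \<epsilon>" if "N \<le> m" "m \<le> n" "x \<in> topspace X" for m n x
    proof -
      have "0 \<le> 3 * B / 2^n"
        using B by simp
      then show ?thesis
        using tail[of x m "n - m"] N[of m] that by simp
    qed
    then show ?thesis
      by (metis commute nle_le)
  qed
  obtain F where F: "continuous_map X mtopology F"
    and gF: "\<And>\<epsilon>. 0 < \<epsilon> \<Longrightarrow> \<forall>\<^sub>F n in sequentially. \<forall>x\<in>topspace X. d (g n x) (F x) < \<epsilon>"
    by (rule continuous_map_uniformly_Cauchy_limit[OF M(2) _ Cauchy]) (use g in simp, blast, blast)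
  have "F a = f a" if a: "a \<in> A" for a
  proof (rule ccontr)
    assume "F a \<noteq> f a"
    have FM: "F a \<in> M"
      using F a AX by (auto simp: continuous_map_def)
    \<comment> \<open>For large \<open>n\<close>, both \<open>F a\<close> and \<open>f a\<close> are
      closer to \<open>g n a\<close> than half their mutual distance, against the triangle
      inequality.\<close>
    then have "0 < d (F a) (f a) / 2" (is "0 < ?\<epsilon>")
      using \<open>F a \<noteq> f a\<close> fM a by auto
    then have "\<forall>\<^sub>F n in sequentially. d (g n a) (F a) < ?\<epsilon> \<and> B / 2^n < ?\<epsilon>"
      using gF[of ?\<epsilon>] small[of ?\<epsilon> B] a AX
      by (intro eventually_conj) (auto elim!: eventually_mono simp del: less_divide_eq_numeral1)
    then obtain n where "d (g n a) (F a) < ?\<epsilon>" "B / 2^n < ?\<epsilon>"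
      using eventually_happens' by force
    moreover have "d (F a) (f a) \<le> d (g n a) (F a) + d (g n a) (f a)"
      using triangle''[of "F a" "g n a" "f a"] triangle[of "F a" "g n a" "f a"] FM fM gM a AX commute by auto
    ultimately show False
      using gf[OF a, of n] by linarith
  qed
  with F show thesis
    using that by (simp add: Yd)
qed

text \<open>Local compactness puts each compact \<open>K n\<close> into an open set inside a compact
  one, and ultranormality fits a clopen, hence compact, \<open>V n\<close> in between. Making the
  sequence \<open>V\<close> disjoint preserves these properties.\<close>

lemma clopen_compact_partition:
  assumes X: "ultranormal_space X" "sigma_compact_space X" "locally_compact_space X"
    "Hausdorff_space X"
  obtains U :: "nat \<Rightarrow> 'a set"
  where "\<And>n. openin X (U n)" "\<And>n. closedin X (U n)" "\<And>n. compactin X (U n)"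
    "disjoint_family U" "(\<Union>n. U n) = topspace X"
proof -
  obtain \<K> where \<K>: "countable \<K>" "\<forall>K\<in>\<K>. compactin X K" "\<Union>\<K> = topspace X"
    using X(2) unfolding sigma_compact_space_def by meson
  \<comment> \<open>The empty set makes the family non-empty, so that it can be enumerated by the
    naturals even when \<open>\<K>\<close> is empty.\<close>
  define \<K>' where "\<K>' = insert {} \<K>"
  define K where "K = from_nat_into \<K>'"
  have "range K = \<K>'"
    unfolding K_def by (rule range_from_nat_into) (auto simp: \<K>'_def \<K>)
  then have UK: "(\<Union>n. K n) = topspace X" and "K n \<in> insert {} \<K>" for n
    using \<K> by (auto simp: \<K>'_def)
  then have K: "compactin X (K n)" for n
    using \<K>(2) by (metis compactin_empty insertE)
  have "\<exists>V. openin X V \<and> closedin X V \<and> compactin X V \<and> K n \<subseteq> V" for n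
  proof -
    obtain G L where G: "openin X G" "compactin X L" "K n \<subseteq> G" "G \<subseteq> L"
      using X K[of n] locally_compact_space_compact_closed_compact by metis
    have "closedin X (K n)" "closedin X (topspace X - G)" "K n \<inter> (topspace X - G) = {}"
      using compactin_imp_closedin X K G by auto
    then obtain V where V: "openin X V" "closedin X V" "K n \<subseteq> V" "V \<inter> (topspace X - G) = {}"
      using X(1) unfolding ultranormal_space_def by meson
    then have "V \<subseteq> L"
      using G openin_subset[OF V(1)] by blast
    then show ?thesis
      using V closed_compactin[OF G(2) \<open>V \<subseteq> L\<close> V(2)] by blast
  qed
  then obtain V where V: "\<And>n. openin X (V n) \<and> closedin X (V n) \<and> compactin X (V n)"
    and KV: "\<And>n. K n \<subseteq> V n"
    by metis
  show thesis
  proof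
    \<comment> \<open>Only the finitely many earlier \<open>V i\<close> are removed from
      \<open>V n\<close>, so the difference stays clopen.\<close>
    show op: "openin X (disjointed V n)" for n
      unfolding disjointed_def using V by (intro openin_diff closedin_Union) auto
    show cl: "closedin X (disjointed V n)" for n
      unfolding disjointed_def using V by (intro closedin_diff openin_Union) auto
    show "compactin X (disjointed V n)" for n
      using V cl closed_compactin disjointed_subset by metis
    show "disjoint_family (disjointed V)"
      by (rule disjoint_family_disjointed)
    show "(\<Union>n. disjointed V n) = topspace X"
      unfolding UN_disjointed_eq
    proof
      show "(\<Union>n. V n) \<subseteq> topspace X"
        using V openin_subset by (intro UN_least) auto
      show "topspace X \<subseteq> (\<Union>n. V n)"
        unfolding UK[symmetric] using KV by (rule UN_mono[OF subset_refl])
    qed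
  qed
qed

text \<open>Non-compactness yields a sequence without convergent subsequence. Infinitely many terms
  in a compact \<open>K\<close> would form a subsequence in \<open>K\<close>, which in turn has a
  convergent subsequence.\<close>

lemma noncompact_metrizable_escaping_sequence:
  assumes "metrizable_space Y" "\<not> compact_space Y"
  obtains y :: "nat \<Rightarrow> 'a" where "range y \<subseteq> topspace Y"
    "\<And>K. compactin Y K \<Longrightarrow> finite {n. y n \<in> K}"
proof -
  obtain M d where "Metric_space M d" and Yd: "Y = Metric_space.mtopology M d"
    using assms unfolding metrizable_space_def by blast
  interpret Metric_space M d by fact
  obtain y :: "nat \<Rightarrow> 'a" where y: "range y \<subseteq> M"
    and nolim: "\<And>l r. \<lbrakk>l \<in> M; strict_mono r\<rbrakk> \<Longrightarrow> \<not> limitin mtopology (y \<circ> r) l sequentially"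
    using assms(2) unfolding Yd compact_space_sequentially by blast
  have "finite {n. y n \<in> K}" if K: "compactin mtopology K" for K
  proof (rule ccontr)
    assume inf: "infinite {n. y n \<in> K}"
    define s where "s = enumerate {n. y n \<in> K}"
    have s: "strict_mono s"
      unfolding s_def using inf by (rule strict_mono_enumerate)
    have "range (y \<circ> s) \<subseteq> K"
      using enumerate_in_set[OF inf] by (auto simp: s_def)
    then obtain l r where "l \<in> K" "strict_mono r" "limitin mtopology ((y \<circ> s) \<circ> r) l sequentially"
      using K unfolding compactin_sequentially by blast
    moreover have "K \<subseteq> M"
      using K compactin_subset_topspace by fastforce
    ultimately show False
      using nolim[of l "s \<circ> r"] s by (auto simp: strict_mono_o o_assoc)
  qed
  with y show thesis
    using that by (auto simp: Yd)
qed

theorem corollary3p13: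
  fixes X :: "'a topology" and Y :: "'b topology" and A :: "'a set" and f :: "'a \<Rightarrow> 'b"
  assumes "ultranormal_space X"
    and "sigma_compact_space X"
    and "locally_compact_space X"
    and "Hausdorff_space X"
    and "closedin X A"
    and "A \<noteq> {}"
    and "metrizable_space Y"
    and "\<not> compact_space Y"
    and "continuous_map (subtopology X A) Y f"
    and "compact_preimage_map (subtopology X A) Y f"
  shows "\<exists>F. continuous_map X Y F \<and> compact_preimage_map X Y F \<and> (\<forall>x\<in>A. F x = f x)"
proof -
  have AX: "A \<subseteq> topspace X"
    using assms(5) closedin_subset by blast
  obtain U :: "nat \<Rightarrow> 'a set" where U: "\<And>n. openin X (U n)" "\<And>n. closedin X (U n)"
      "\<And>n. compactin X (U n)" and disj: "disjoint_family U" and UX: "(\<Union>n. U n) = topspace X"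
    using clopen_compact_partition[OF assms(1-4)] by metis
  obtain y :: "nat \<Rightarrow> 'b" where y: "range y \<subseteq> topspace Y"
    and yfin: "\<And>K. compactin Y K \<Longrightarrow> finite {n. y n \<in> K}"
    using noncompact_metrizable_escaping_sequence[OF assms(7,8)] by metis
  \<comment> \<open>The local maps are built on all of \<open>X\<close>, although only their
    restrictions to \<open>U n\<close> are glued. The constraint on their values is what gives
    properness at the end.\<close>
  have "\<exists>g. continuous_map X Y g \<and> (\<forall>a\<in>A \<inter> U n. g a = f a) \<and>
      (\<forall>x\<in>topspace X. g x \<in> (if A \<inter> U n = {} then {y n} else f ` (A \<inter> U n)))" for n
  proof (cases "A \<inter> U n = {}")
    case True
    then show ?thesis
      using y by (intro exI[of _ "\<lambda>x. y n"]) auto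
  next
    case False
    have cl: "closedin X (A \<inter> U n)"
      using assms(5) U by blast
    have f': "continuous_map (subtopology X (A \<inter> U n)) Y f"
      using assms(9) by (rule continuous_map_from_subtopology_mono) auto
    \<comment> \<open>Extending into this compact subspace, rather than into \<open>Y\<close>, both
      makes the extension possible and confines its values.\<close>
    let ?Y = "subtopology Y (f ` (A \<inter> U n))"
    have "compactin X (A \<inter> U n)"
      using U(3) cl closed_compactin by (metis inf_le2)
    then have com: "compactin Y (f ` (A \<inter> U n))"
      using image_compactin[OF _ f'] by (simp add: compactin_subtopology)
    have f'': "continuous_map (subtopology X (A \<inter> U n)) ?Y f"
      using f' by (auto simp: continuous_map_in_subtopology)
    have top: "topspace ?Y = f ` (A \<inter> U n)"
      using compactin_subset_topspace[OF com] by auto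
    have "compact_space ?Y"
      using com by (rule compact_space_subtopology)
    moreover have "metrizable_space ?Y"
      using assms(7) by (rule metrizable_space_subtopology)
    moreover have "topspace ?Y \<noteq> {}"
      unfolding top using False by blast
    ultimately obtain g where g: "continuous_map X ?Y g" "\<And>a. a \<in> A \<inter> U n \<Longrightarrow> g a = f a"
      using ultranormal_extension[OF assms(1) cl _ _ _ f''] by blast
    then have "continuous_map X Y g" "\<forall>x\<in>topspace X. g x \<in> f ` (A \<inter> U n)"
      using g(1) by (auto simp: continuous_map_in_subtopology)
    then show ?thesis
      using g False by auto
  qed
  then obtain g where g: "\<And>n. continuous_map X Y (g n)"
    and gf: "\<And>n a. \<lbrakk>a \<in> A; a \<in> U n\<rbrakk> \<Longrightarrow> g n a = f a"
    and gim: "\<And>n x. x \<in> topspace X \<Longrightarrow>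
      g n x \<in> (if A \<inter> U n = {} then {y n} else f ` (A \<inter> U n))"
    by (metis IntI)
  have disj': "i = j" if "x \<in> U i" "x \<in> U j" for i j x
    using disj that unfolding disjoint_family_on_def by blast
  \<comment> \<open>Distinct pieces are disjoint, so the overlap condition for pasting only concerns
    \<open>i = j\<close>.\<close>
  then have eq: "g i x = g j x" if "x \<in> topspace X \<inter> U i \<inter> U j" for i j x
    using that by blast
  have cont: "continuous_map (subtopology X (U i)) Y (g i)" for i
    using g by (rule continuous_map_from_subtopology)
  obtain F where F: "continuous_map X Y F" and Fg: "\<And>x n. x \<in> topspace X \<inter> U n \<Longrightarrow> F x = g n x"
  proof (rule pasting_lemma_exists[OF equalityD2[OF UX] U(1) cont eq])
    fix F
    assume "continuous_map X Y F" "\<And>x i. \<lbrakk>i \<in> UNIV; x \<in> topspace X \<inter> U i\<rbrakk> \<Longrightarrow> F x = g i x"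
    then show thesis
      by (intro that[of F]) simp_all
  qed
  have "F a = f a" if "a \<in> A" for a
    using that AX UX Fg gf by (metis IntI UN_E subsetD)
  moreover have "compactin X {x \<in> topspace X. F x \<in> K}" (is "compactin X ?P")
    if K: "compactin Y K" for K
  proof -
    let ?Q = "{a \<in> topspace (subtopology X A). f a \<in> K}"
    have Q: "compactin X ?Q"
      using assms(10) K unfolding compact_preimage_map_def by (simp add: compactin_subtopology)
    \<comment> \<open>Properness of \<open>f\<close> makes \<open>?Q\<close> compact, so finitely
      many of the open pieces cover it.\<close>
    obtain \<F> where \<F>: "finite \<F>" "\<F> \<subseteq> range U" "?Q \<subseteq> \<Union>\<F>"
      using compactinD[OF Q, of "range U"] U UX by auto
    obtain N where "finite N" "\<F> = U ` N"
      using finite_subset_image[OF \<F>(1,2)] by blast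
    with \<F>(3) have N: "finite N" "?Q \<subseteq> (\<Union>n\<in>N. U n)"
      by simp_all
    \<comment> \<open>\<open>N\<close> accounts for the pieces that meet \<open>A\<close>, the
      second set for those that carry a constant \<open>y n\<close>.\<close>
    let ?N = "N \<union> {n. y n \<in> K}"
    have "?P \<subseteq> (\<Union>n\<in>?N. U n)"
    proof
      fix x
      assume x: "x \<in> ?P"
      then obtain n where n: "x \<in> U n"
        using UX by blast
      have gK: "g n x \<in> K"
        using x n Fg by auto
      have "n \<in> ?N"
      proof (cases "A \<inter> U n = {}")
        case True
        then show ?thesis
          using gim[of x n] x gK by auto
      next
        case False
        \<comment> \<open>The value \<open>g n x\<close> is attained by \<open>f\<close> at some
          \<open>a\<close> in the same piece. This \<open>a\<close> lies in \<open>?Q\<close>, so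
          the piece is indexed by \<open>N\<close>.\<close>
        then obtain a where a: "a \<in> A" "a \<in> U n" "f a \<in> K"
          using gim[of x n] x gK by auto
        then obtain m where "m \<in> N" "a \<in> U m"
          using N(2) AX by auto
        then have "m = n"
          using a disj' by blast
        then show ?thesis
          using \<open>m \<in> N\<close> by simp
      qed
      with n show "x \<in> (\<Union>n\<in>?N. U n)"
        by blast
    qed
    moreover have "compactin X (\<Union>n\<in>?N. U n)"
      using N(1) yfin[OF K] U(3) by (intro compactin_Union) auto
    \<comment> \<open>\<open>K\<close> is closed because \<open>Y\<close> is Hausdorff, so
      \<open>?P\<close> is a closed subset of a finite union of compact pieces.\<close>
    moreover have "closedin X ?P"
      using F K assms(7) metrizable_imp_Hausdorff_space compactin_imp_closedin
        closedin_continuous_map_preimage by metis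
    ultimately show ?thesis
      by (meson closed_compactin)
  qed
  ultimately show ?thesis
    using F unfolding compact_preimage_map_def by (auto simp: continuous_map_def)
qed

end
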